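(* Let $W$ be the set of states of a world containing an agent with action set $A$, and let $\sim$ be the equivalence relation on $A$ given by $a\sim a'$ iff $a*w=a'*w$ for all $w\in W$. Suppose the following condition fails: for each $a\in A/\sim$ there exists $a'\in A/\sim$ such that $(a'\circ a)*w=w$ and $(a\circ a')*w=w$ for all $w\in W$. Then $(A/\sim,\circ)$ is not a group, and hence $*:(A/\sim)\times W\to W$ is not a group action.
   Context: A world is a directed multigraph $(W,\hat D,s,t)$ with vertex set $W$ (world states), arrow set $\hat D$ and source and target maps $s,t:\hat D\to W$; for each $w\in W$ there is a distinguished trivial arrow $1_w\in\hat D$ with $s(1_w)=t(1_w)=w$. $D$ is the set of all paths $\hat d_n\circ\cdots\circ\hat d_1$ ($n\ge 1$, $t(\hat d_i)=s(\hat d_{i+1})$), with $s,t$ extended to paths by taking the source of the first arrow and the target of the last. Agent and actions. There is a set $\hat A$ (minimum actions); $A$ is the set of all nonempty finite sequences of elements of $\hat A$, and $\circ$ on $A$ is concatenation, with $a'\circ a$ meaning "first $a$, then $a'$". There is a subset $\hat D_A\subset D$ (minimum action transitions) with $1_w\in\hat D_A$ for all $w\in W$, and a labelling map $\hat l:\hat D_A\to\hat A$ such that: (i) if $d\ne d'$ in $\hat D_A$ have $s(d)=s(d')$ then $\hat l(d)\neq\hat l(d')$; (ii) there is an element $1\in\hat A$ (the identity action) with $\hat l(1_w)=1$ for all $w\in W$. $D_A$ is the set of all nonempty paths in the multigraph with vertices $W$ and arrows $\hat D_A$; the labelling extends to $l:D_A\to A$ by $l(d_n\circ\cdots\circ d_1)=\hat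 l(d_n)\cdots\hat l(d_1)$. Standing assumption: every world state transition is due to the agent, i.e. $D=D_A$ (every path in $D$ is a composite of minimum action transitions). Effect of actions. For $a\in A$, $w\in W$: if there is $d\in D_A$ with $s(d)=w$ and $l(d)=a$, then $a*w=t(d)$ (unambiguous by (i)); otherwise $a*w$ is undefined. The equality $a*w=a'*w$ means that either both sides are undefined, or both are defined and equal. $[a]_\sim$ denotes the class of $a$; composition on $A/\sim$ is the (well-defined) operation $[a']_\sim\circ[a]_\sim=[a'\circ a]_\sim$, and the effect of a class on a state is $[a]_\sim*w=a*w$ (undefined if $a*w$ is undefined), so a priori $*$ is only a partial operation. "$*$ is a group action" means: $(A/\sim,\circ)$ is a group, $*$ is everywhere defined on $(A/\sim)\times W$, the group identity fixes every $w\in W$, and $g'*(g*w)=(g'\circ g)*w$ for all $g,g'\in A/\sim$, $w\in W$. *)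

theory Defs
  imports "Graph_Theory.Arc_Walk" "HOL-Algebra.Group"
begin

text \<open>
  Paths are nonempty arc lists in order of traversal, so the composite
  \<open>d\<^sub>n \<circ> \<dots> \<circ> d\<^sub>1\<close> is the list \<open>[d\<^sub>1, \<dots>, d\<^sub>n]\<close>.
\<close>

definition paths :: "('v, 'e) pre_digraph \<Rightarrow> 'e list set" where
  "paths G = {p. p \<noteq> [] \<and> (\<exists>u v. pre_digraph.awalk G u p v)}"

definition source :: "('v, 'e) pre_digraph \<Rightarrow> 'e list \<Rightarrow> 'v" where
  "source G p = tail G (hd p)"

definition target :: "('v, 'e) pre_digraph \<Rightarrow> 'e list \<Rightarrow> 'v" where
  "target G p = head G (last p)"

text \<open>
  A minimum action transition is itself a path of the world, i.e. an arc list.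
\<close>

record ('w, 'd, 'a) agent_world =
  world :: "('w, 'd) pre_digraph"
  triv :: "'w \<Rightarrow> 'd"
  min_actions :: "'a set"
  min_trans :: "'d list set"
  min_label :: "'d list \<Rightarrow> 'a"
  id_action :: "'a"

abbreviation states :: "('w, 'd, 'a) agent_world \<Rightarrow> 'w set" where
  "states E \<equiv> verts (world E)"

definition actions :: "('w, 'd, 'a) agent_world \<Rightarrow> 'a list set" where
  "actions E = {a. a \<noteq> [] \<and> set a \<subseteq> min_actions E}"

text \<open>
  \<open>act_comp a' a\<close> is \<open>a' \<circ> a\<close>, that is, first \<open>a\<close>, then \<open>a'\<close>; action sequences, like
  paths, are listed in order of execution.
\<close>

definition act_comp :: "'a list \<Rightarrow> 'a list \<Rightarrow> 'a list" where
  "act_comp a' a = a @ a'"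

definition trans_graph :: "('w, 'd, 'a) agent_world \<Rightarrow> ('w, 'd list) pre_digraph" where
  "trans_graph E = \<lparr>verts = states E, arcs = min_trans E,
     tail = source (world E), head = target (world E)\<rparr>"

abbreviation agent_paths :: "('w, 'd, 'a) agent_world \<Rightarrow> 'd list list set" where
  "agent_paths E \<equiv> paths (trans_graph E)"

definition label :: "('w, 'd, 'a) agent_world \<Rightarrow> 'd list list \<Rightarrow> 'a list" where
  "label E p = map (min_label E) p"

text \<open>
  In the last axiom, an element of \<open>agent_paths E\<close> is a list of paths of the world; \<open>concat\<close>
  composes them to a single path of the world.
\<close>

locale agent_world =
  fixes E :: "('w, 'd, 'a) agent_world"
  assumes wf_world: "wf_digraph (world E)"
    and triv_arc: "w \<in> states E \<Longrightarrow> triv E w \<in> arcs (world E)"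
    and triv_tail: "w \<in> states E \<Longrightarrow> tail (world E) (triv E w) = w"
    and triv_head: "w \<in> states E \<Longrightarrow> head (world E) (triv E w) = w"
    and min_trans_paths: "min_trans E \<subseteq> paths (world E)"
    and triv_min_trans: "w \<in> states E \<Longrightarrow> [triv E w] \<in> min_trans E"
    and min_label_closed: "d \<in> min_trans E \<Longrightarrow> min_label E d \<in> min_actions E"
    and min_label_inj: "\<lbrakk>d \<in> min_trans E; d' \<in> min_trans E; d \<noteq> d';
      source (world E) d = source (world E) d'\<rbrakk> \<Longrightarrow> min_label E d \<noteq> min_label E d'"
    and id_action_closed: "id_action E \<in> min_actions E"
    and triv_label: "w \<in> states E \<Longrightarrow> min_label E [triv E w] = id_action E"
    and all_due_to_agent: "paths (world E) = concat ` agent_paths E"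

text \<open>
  \<open>None\<close> stands for ``undefined'', so that equality of options is the equality of possibly
  undefined effects.
\<close>

definition effect :: "('w, 'd, 'a) agent_world \<Rightarrow> 'a list \<Rightarrow> 'w \<Rightarrow> 'w option" where
  "effect E a w =
    (if \<exists>d \<in> agent_paths E. source (trans_graph E) d = w \<and> label E d = a
     then Some (THE v. \<exists>d \<in> agent_paths E.
       source (trans_graph E) d = w \<and> label E d = a \<and> v = target (trans_graph E) d)
     else None)"

definition act_equiv :: "('w, 'd, 'a) agent_world \<Rightarrow> ('a list \<times> 'a list) set" where
  "act_equiv E = {(a, a'). a \<in> actions E \<and> a' \<in> actions E \<and>
     (\<forall>w \<in> states E. effect E a w = effect E a' w)}"

definition act_classes :: "('w, 'd, 'a) agent_world \<Rightarrow> 'a list set set" where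
  "act_classes E = actions E // act_equiv E"

definition class_comp ::
    "('w, 'd, 'a) agent_world \<Rightarrow> 'a list set \<Rightarrow> 'a list set \<Rightarrow> 'a list set" where
  "class_comp E X' X = (\<Union>a' \<in> X'. \<Union>a \<in> X. act_equiv E `` {act_comp a' a})"

definition class_effect :: "('w, 'd, 'a) agent_world \<Rightarrow> 'a list set \<Rightarrow> 'w \<Rightarrow> 'w option" where
  "class_effect E X w = the_elem ((\<lambda>a. effect E a w) ` X)"

text \<open>
  A set with a binary operation is a group if some element serves as the identity; the identity is
  not prescribed in advance.
\<close>

definition is_group_with :: "'g set \<Rightarrow> ('g \<Rightarrow> 'g \<Rightarrow> 'g) \<Rightarrow> 'g \<Rightarrow> bool" where
  "is_group_with C m e \<longleftrightarrow> group \<lparr>carrier = C, mult = m, one = e\<rparr>"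

definition is_group :: "'g set \<Rightarrow> ('g \<Rightarrow> 'g \<Rightarrow> 'g) \<Rightarrow> bool" where
  "is_group C m \<longleftrightarrow> (\<exists>e. is_group_with C m e)"

definition is_group_action ::
    "'g set \<Rightarrow> ('g \<Rightarrow> 'g \<Rightarrow> 'g) \<Rightarrow> 'w set \<Rightarrow> ('g \<Rightarrow> 'w \<Rightarrow> 'w option) \<Rightarrow> bool" where
  "is_group_action C m W act \<longleftrightarrow>
    (\<exists>e. is_group_with C m e \<and>
      (\<forall>g \<in> C. \<forall>w \<in> W. \<exists>v \<in> W. act g w = Some v) \<and>
      (\<forall>w \<in> W. act e w = Some w) \<and>
      (\<forall>g \<in> C. \<forall>g' \<in> C. \<forall>w \<in> W. Option.bind (act g w) (act g') = act (m g' g) w))"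

text \<open>
  The remaining facts show that the choices made in \<open>effect\<close>, \<open>class_comp\<close> and \<open>class_effect\<close>
  are unambiguous.
\<close>

context agent_world
begin

lemma min_trans_target:
  assumes "d \<in> min_trans E"
  shows "target (world E) d \<in> states E"
proof -
  from assms min_trans_paths have "d \<noteq> []" "set d \<subseteq> arcs (world E)"
    by (auto simp: paths_def pre_digraph.awalk_def)
  then have "last d \<in> arcs (world E)"
    by auto
  then show ?thesis
    by (simp add: target_def wf_digraph.head_in_verts[OF wf_world])
qed

lemma cas_unique:
  assumes "pre_digraph.cas (trans_graph E) u p v" "pre_digraph.cas (trans_graph E) u q v'"
    "set p \<subseteq> min_trans E" "set q \<subseteq> min_trans E" "label E p = label E q"
  shows "p = q"
  using assms
proof (induction p arbitrary: u q)
  case Nil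
  then show ?case by (simp add: label_def)
next
  case (Cons d p)
  then obtain d' q' where q: "q = d' # q'"
    by (cases q) (auto simp: label_def)
  note cas = pre_digraph.cas.simps
  have "d = d'"
    using Cons.prems min_label_inj[of d d']
    by (auto simp: q cas label_def trans_graph_def)
  moreover have "p = q'"
    using Cons.prems Cons.IH[of "head (trans_graph E) d" q'] \<open>d = d'\<close>
    by (auto simp: q cas label_def)
  ultimately show ?case
    by (simp add: q)
qed

lemma agent_path_iff:
  "p \<in> agent_paths E \<and> source (trans_graph E) p = w \<and> target (trans_graph E) p = v \<longleftrightarrow>
   p \<noteq> [] \<and> w \<in> states E \<and> set p \<subseteq> min_trans E \<and> pre_digraph.cas (trans_graph E) w p v"
proof -
  have end_eq: "v' = head (trans_graph E) (last q)"
    if "pre_digraph.cas (trans_graph E) u q v'" "q \<noteq> []" for u v' q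
    using that by (induction q arbitrary: u) (auto simp: pre_digraph.cas.simps split: if_splits)
  show ?thesis
    unfolding paths_def pre_digraph.awalk_def source_def target_def mem_Collect_eq
  proof (intro iffI)
    assume L: "(p \<noteq> [] \<and> (\<exists>u v. u \<in> verts (trans_graph E) \<and> set p \<subseteq> arcs (trans_graph E) \<and>
      pre_digraph.cas (trans_graph E) u p v)) \<and>
      tail (trans_graph E) (hd p) = w \<and> head (trans_graph E) (last p) = v"
    then obtain u v' where "p \<noteq> []" "u \<in> verts (trans_graph E)"
      "set p \<subseteq> arcs (trans_graph E)" and c: "pre_digraph.cas (trans_graph E) u p v'"
      by blast
    moreover have "u = w" "v' = v"
      using c L end_eq[OF c] \<open>p \<noteq> []\<close> by (auto simp: pre_digraph.cas_simp)
    ultimately show "p \<noteq> [] \<and> w \<in> states E \<and> set p \<subseteq> min_trans E \<and>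
        pre_digraph.cas (trans_graph E) w p v"
      by (simp add: trans_graph_def)
  next
    assume R: "p \<noteq> [] \<and> w \<in> states E \<and> set p \<subseteq> min_trans E \<and>
      pre_digraph.cas (trans_graph E) w p v"
    then have "tail (trans_graph E) (hd p) = w" "head (trans_graph E) (last p) = v"
      using end_eq by (auto simp: pre_digraph.cas_simp)
    with R show "(p \<noteq> [] \<and> (\<exists>u v. u \<in> verts (trans_graph E) \<and> set p \<subseteq> arcs (trans_graph E) \<and>
      pre_digraph.cas (trans_graph E) u p v)) \<and>
      tail (trans_graph E) (hd p) = w \<and> head (trans_graph E) (last p) = v"
      by (auto simp: trans_graph_def)
  qed
qed

lemma effect_eq_Some_iff:
  "effect E a w = Some v \<longleftrightarrow>
   (\<exists>d \<in> agent_paths E. source (trans_graph E) d = w \<and> label E d = a \<and>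
     target (trans_graph E) d = v)"
proof -
  have uniq: "d = d'"
    if "d \<in> agent_paths E" "source (trans_graph E) d = w" "label E d = a"
      "d' \<in> agent_paths E" "source (trans_graph E) d' = w" "label E d' = a" for d d'
    using that cas_unique[of w d "target (trans_graph E) d" d' "target (trans_graph E) d'"]
      agent_path_iff[of d w "target (trans_graph E) d"]
      agent_path_iff[of d' w "target (trans_graph E) d'"] by auto
  show ?thesis
  proof (cases "\<exists>d \<in> agent_paths E. source (trans_graph E) d = w \<and> label E d = a")
    case True
    then obtain d where d: "d \<in> agent_paths E" "source (trans_graph E) d = w" "label E d = a"
      by blast
    have "(THE v. \<exists>d \<in> agent_paths E. source (trans_graph E) d = w \<and> label E d = a \<and>
      v = target (trans_graph E) d) = target (trans_graph E) d"
      using d uniq by (intro the_equality) blast+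
    then show ?thesis
      using d uniq unfolding effect_def by auto
  next
    case False
    then show ?thesis
      by (auto simp: effect_def)
  qed
qed

lemma equiv_act_equiv: "equiv (actions E) (act_equiv E)"
  by (auto simp: equiv_def refl_on_def sym_def trans_def act_equiv_def)

lemma effect_act_comp:
  assumes "a \<in> actions E" "a' \<in> actions E"
  shows "effect E (act_comp a' a) w = Option.bind (effect E a w) (effect E a')"
proof -
  have a: "a \<noteq> []" "a' \<noteq> []"
    using assms by (auto simp: actions_def)
  have effect_iff: "effect E b x = Some v \<longleftrightarrow> (\<exists>p. p \<noteq> [] \<and> x \<in> states E \<and>
      set p \<subseteq> min_trans E \<and> pre_digraph.cas (trans_graph E) x p v \<and> label E p = b)" for b x v
    unfolding effect_eq_Some_iff using agent_path_iff by blast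
  have app: "pre_digraph.cas (trans_graph E) u (p @ q) v \<longleftrightarrow>
      (\<exists>x. pre_digraph.cas (trans_graph E) u p x \<and> pre_digraph.cas (trans_graph E) x q v)"
    for u p q v
    by (induction p arbitrary: u) (auto simp: pre_digraph.cas.simps)
  have st: "v \<in> states E"
    if "pre_digraph.cas (trans_graph E) u p v" "u \<in> states E" "set p \<subseteq> min_trans E" for u p v
    using that by (induction p arbitrary: u)
      (auto simp: pre_digraph.cas.simps trans_graph_def intro: min_trans_target)
  have "effect E (act_comp a' a) w = Some v \<longleftrightarrow>
      Option.bind (effect E a w) (effect E a') = Some v" (is "?L \<longleftrightarrow> ?R") for v
  proof
    assume ?L
    then obtain p where p: "p \<noteq> []" "w \<in> states E" "set p \<subseteq> min_trans E"
      "pre_digraph.cas (trans_graph E) w p v" "label E p = a @ a'"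
      unfolding effect_iff act_comp_def by blast
    then obtain p1 p2 where s: "p = p1 @ p2" "label E p1 = a" "label E p2 = a'"
      by (auto simp: label_def map_eq_append_conv)
    then obtain x where x: "pre_digraph.cas (trans_graph E) w p1 x"
      "pre_digraph.cas (trans_graph E) x p2 v"
      using p app by blast
    have ne: "p1 \<noteq> []" "p2 \<noteq> []"
      using a s by (auto simp: label_def)
    have "x \<in> states E"
      using st[OF x(1)] p s by auto
    then have "effect E a w = Some x" "effect E a' x = Some v"
      unfolding effect_iff using p s x ne by auto
    then show ?R by simp
  next
    assume ?R
    then obtain x where "effect E a w = Some x" "effect E a' x = Some v"
      by (auto simp: bind_eq_Some_conv)
    then obtain p1 p2 where "p1 \<noteq> []" "w \<in> states E" "set p1 \<subseteq> min_trans E"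
      "pre_digraph.cas (trans_graph E) w p1 x" "label E p1 = a"
      "p2 \<noteq> []" "set p2 \<subseteq> min_trans E"
      "pre_digraph.cas (trans_graph E) x p2 v" "label E p2 = a'"
      unfolding effect_iff by blast
    then show ?L
      unfolding effect_iff act_comp_def
      by (intro exI[of _ "p1 @ p2"]) (auto simp: app label_def)
  qed
  then show ?thesis
    by (metis option.exhaust)
qed

lemma effect_in_states: "effect E a w = Some v \<Longrightarrow> v \<in> states E"
proof -
  assume "effect E a w = Some v"
  then obtain p where p: "p \<in> agent_paths E" "target (trans_graph E) p = v"
    by (auto simp: effect_eq_Some_iff)
  then have "last p \<in> min_trans E"
    by (auto simp: paths_def pre_digraph.awalk_def trans_graph_def dest: last_in_set)
  from min_trans_target[OF this] p(2) show ?thesis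
    unfolding target_def[of "trans_graph E"] by (simp add: trans_graph_def)
qed

lemma act_comp_congruent:
  assumes "(a, b) \<in> act_equiv E" "(a', b') \<in> act_equiv E"
  shows "(act_comp a' a, act_comp b' b) \<in> act_equiv E"
proof -
  have mem: "a \<in> actions E" "b \<in> actions E" "a' \<in> actions E" "b' \<in> actions E"
    using assms by (auto simp: act_equiv_def)
  have "effect E (act_comp a' a) w = effect E (act_comp b' b) w" if "w \<in> states E" for w
    using assms that mem effect_in_states[of a w]
    by (cases "effect E a w") (auto simp: effect_act_comp act_equiv_def)
  then show ?thesis
    using mem by (auto simp: act_equiv_def act_comp_def actions_def)
qed

lemma class_comp_class:
  assumes "a \<in> actions E" "a' \<in> actions E"
  shows "class_comp E (act_equiv E `` {a'}) (act_equiv E `` {a}) =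
    act_equiv E `` {act_comp a' a}"
proof -
  have "act_equiv E `` {act_comp b' b} = act_equiv E `` {act_comp a' a}"
    if "b \<in> act_equiv E `` {a}" "b' \<in> act_equiv E `` {a'}" for b b'
    using that act_comp_congruent[of a b a' b'] equiv_class_eq[OF equiv_act_equiv] by blast
  moreover have "a \<in> act_equiv E `` {a}" "a' \<in> act_equiv E `` {a'}"
    using assms by (auto simp: act_equiv_def)
  ultimately show ?thesis
    unfolding class_comp_def by blast
qed

lemma class_effect_class:
  assumes "a \<in> actions E" "w \<in> states E"
  shows "class_effect E (act_equiv E `` {a}) w = effect E a w"
proof -
  have "(\<lambda>a. effect E a w) ` (act_equiv E `` {a}) = {effect E a w}"
    using assms by (auto simp: act_equiv_def image_iff)
  then show ?thesis
    by (simp add: class_effect_def)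
qed

end

end

theory Submission
  imports Defs
begin

text \<open>
  The identity action fixes every state, so its class is a unit for composition and is therefore
  the unit of any group structure on the classes; group inverses then compose to a class that
  fixes every state.
\<close>

context agent_world
begin

lemma id_action_actions: "[id_action E] \<in> actions E"
  by (simp add: actions_def id_action_closed)

lemma effect_id_action:
  assumes "w \<in> states E"
  shows "effect E [id_action E] w = Some w"
proof -
  \<comment> \<open>The witness is the one-step path along the trivial transition at
    \<open>w\<close>. The brackets are double because a minimum transition is itself a list of world
    arcs.\<close>
  have "[[triv E w]] \<in> agent_paths E \<and> source (trans_graph E) [[triv E w]] = w \<and>
      target (trans_graph E) [[triv E w]] = w"
    unfolding agent_path_iff
    using assms triv_min_trans
    by (simp add: pre_digraph.cas.simps trans_graph_def source_def target_def triv_tail triv_head)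
  then show ?thesis
    unfolding effect_eq_Some_iff
    using assms by (intro bexI[of _ "[[triv E w]]"]) (auto simp: label_def triv_label)
qed

text \<open>Here the identity action is performed last, after a representative of
  \<open>X\<close>.\<close>

lemma class_comp_id_action:
  assumes "X \<in> act_classes E"
  shows "class_comp E (act_equiv E `` {[id_action E]}) X = X"
proof -
  obtain a where a: "a \<in> actions E" and X: "X = act_equiv E `` {a}"
    using assms unfolding act_classes_def by (rule quotientE)
  \<comment> \<open>An undefined effect of \<open>a\<close> stays undefined under the bind; a
    defined one is again a state, which the identity action fixes.\<close>
  have "effect E (act_comp [id_action E] a) w = effect E a w" for w
    using effect_in_states[of a w]
    by (cases "effect E a w") (auto simp: effect_act_comp a id_action_actions effect_id_action)
  moreover have "act_comp [id_action E] a \<in> actions E"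
    using a id_action_closed by (auto simp: act_comp_def actions_def)
  ultimately have "(act_comp [id_action E] a, a) \<in> act_equiv E"
    using a by (simp add: act_equiv_def)
  then show ?thesis
    by (simp add: X class_comp_class a id_action_actions equiv_class_eq[OF equiv_act_equiv])
qed

text \<open>The unit in \<open>is_group\<close> is only asserted to exist, so its effect on states
  is unknown until it is identified. Composing the identity class after \<open>e\<close> gives the
  identity class, as \<open>e\<close> is a right unit, and also \<open>e\<close>, by
  \<open>class_comp_id_action\<close>.\<close>

lemma group_unit_eq_id_action_class:
  assumes "is_group_with (act_classes E) (class_comp E) e"
  shows "e = act_equiv E `` {[id_action E]}"
proof -
  interpret G: group "\<lparr>carrier = act_classes E, mult = class_comp E, one = e\<rparr>"
    using assms by (simp add: is_group_with_def)
  have "act_equiv E `` {[id_action E]} \<in> act_classes E"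
    unfolding act_classes_def using id_action_actions by (rule quotientI)
  then show ?thesis
    using G.r_one[of "act_equiv E `` {[id_action E]}"] class_comp_id_action[of e] G.one_closed
    by simp
qed

lemma inverse_effects_if_is_group:
  assumes "is_group (act_classes E) (class_comp E)" "X \<in> act_classes E"
  shows "\<exists>X' \<in> act_classes E. \<forall>w \<in> states E.
    class_effect E (class_comp E X' X) w = Some w \<and>
    class_effect E (class_comp E X X') w = Some w"
proof -
  obtain e where e: "is_group_with (act_classes E) (class_comp E) e"
    using assms(1) by (auto simp: is_group_def)
  interpret G: group "\<lparr>carrier = act_classes E, mult = class_comp E, one = e\<rparr>"
    using e by (simp add: is_group_with_def)
  \<comment> \<open>\<open>X'\<close> is the group inverse of \<open>X\<close>, so both composites
    equal \<open>e\<close>.\<close>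
  obtain X' where "X' \<in> act_classes E" "class_comp E X' X = e" "class_comp E X X' = e"
    using assms(2) G.l_inv[of X] G.r_inv[of X] G.inv_closed[of X] by auto
  moreover have "class_effect E e w = Some w" if "w \<in> states E" for w
    using that by (simp add: group_unit_eq_id_action_class[OF e] class_effect_class
      id_action_actions effect_id_action)
  ultimately show ?thesis
    by (intro bexI[of _ X']) simp_all
qed

end

theorem proposition11:
  fixes E :: "('w, 'd, 'a) agent_world"
  assumes "agent_world E"
    and "\<not> (\<forall>X \<in> act_classes E. \<exists>X' \<in> act_classes E. \<forall>w \<in> states E.
      class_effect E (class_comp E X' X) w = Some w \<and>
      class_effect E (class_comp E X X') w = Some w)"
  shows "\<not> is_group (act_classes E) (class_comp E) \<and>
    \<not> is_group_action (act_classes E) (class_comp E) (states E) (class_effect E)"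
proof -
  have "\<not> is_group (act_classes E) (class_comp E)"
    using agent_world.inverse_effects_if_is_group[OF assms(1)] assms(2) by blast
  \<comment> \<open>A group action includes a group structure on the classes, so the second claim
    follows from the first.\<close>
  then show ?thesis
    by (auto simp: is_group_def is_group_action_def)
qed

end
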